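(* Let $\Theta=(\Gamma,(x_{k,i}))$ be a patch framework in $\mathbb{R}^d$ with $m$ views, with $\Gamma$ connected and with every view affinely non-degenerate. If $S$ is a unique perfect alignment then $\mathrm{rank}(\overline{B(S)}_{A,B})=d$ for all non-empty partitions $A$ and $B$ of $\{1,\dots,m\}$, i.e. for all $A,B\subseteq\{1,\dots,m\}$ with $A,B\neq\emptyset$, $A\cap B=\emptyset$ and $A\cup B=\{1,\dots,m\}$.
   Context: Patch framework. $\Gamma$ is a bipartite graph on $n+m$ vertices; vertex $k\in\{1,\dots,n\}$ represents the $k$th point and vertex $n+i$, $i\in\{1,\dots,m\}$, the $i$th view; $(k,i)\in E(\Gamma)$ means that point $k$ is in view $i$, with local coordinates $x_{k,i}\in\mathbb{R}^d$. The tuple $\Theta=(\Gamma,(x_{k,i}))$ is a patch framework. A view $i$ is affinely non-degenerate if it has at least $d+1$ points and the affine span of $\{x_{k,i}:(k,i)\in E(\Gamma)\}$ has dimension $d$. Put $e_{ki}=e_k-e_{n+i}\in\mathbb{R}^{n+m}$, $\varepsilon_i$ the $i$th standard basis vector of $\mathbb{R}^m$, $\mathcal{L}_\Gamma=\sum_{(k,i)\in E(\Gamma)}e_{ki}e_{ki}^T$, $\mathbf{B}=\sum_{(k,i)\in E(\Gamma)}(\varepsilon_i\otimes I_d)x_{k,i}e_{ki}^T$, $D=\sum_{(k,i)\in E(\Gamma)}(\varepsilon_i\otimes I_d)x_{k,i}x_{k,i}^T(\varepsilon_i\otimes I_d)^T$, and $C=D-\mathbf{B}\mathcal{L}_\Gamma^\dagger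 \mathbf{B}^T\in\mathbb{R}^{md\times md}$ (positive semi-definite), where $\dagger$ is the Moore–Penrose pseudoinverse. An alignment is an element $S=[S_i]_1^m$ (vertical stack) of $\mathbb{O}(d)^m\subseteq\mathbb{R}^{md\times d}$; $F(S)=\mathrm{Tr}(CSS^T)$; $S$ is perfect if $F(S)=0$ (hence optimal, i.e. a global minimizer of $F$). An optimal alignment $S$ is unique if every other optimal alignment $O$ is of the form $O=SQ$ for some $Q\in\mathbb{O}(d)$. Overlaps. For an alignment $S$ let $H=S^T\mathbf{B}\mathcal{L}_\Gamma^\dagger(I_{n+m}-n^{-1}\mathbf{1}^{n+m}_n\mathbf{1}_{n+m}^T)\in\mathbb{R}^{d\times(n+m)}$, where $\mathbf{1}^{n+m}_n$ has first $n$ entries $1$ and the rest $0$ and $\mathbf{1}_{p}$ is the all-ones vector of length $p$; let $t_i\in\mathbb{R}^d$ be column $n+i$ of $H$. For a perfect alignment $S$, $S_i^Tx_{k,i}+t_i=S_j^Tx_{k,j}+t_j$ whenever $(k,i),(k,j)\in E(\Gamma)$. For disjoint non-empty $A,B\subseteq\{1,\dots,m\}$, $B(S)_{A,B}$ is the matrix whose columns (in increasing order of $k$) are $S_i^Tx_{k,i}+t_i$, over those $k$ for which $(k,i),(k,j)\in E(\Gamma)$ for some $i\in A$ and $j\in B$ (one column per such $k$). With $n'$ its number of columns, $\overline{B(S)}_{A,B}=B(S)_{A,B}(I_{n'}-(1/n')\mathbf{1}_{n'}\mathbf{1}_{n'}^T)$. *)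

theory Defs
  imports
    "Jordan_Normal_Form.Matrix"
    "Jordan_Normal_Form.DL_Rank"
    "Graph_Theory.Digraph_Component"
begin

text \<open>
  All indices start at 0: points are the k < n, views the i < m, the vertices of the graph are the
  numbers below n + m (point k is vertex k, view i is vertex n + i), and the i-th d-by-d block of a
  stacked matrix consists of the rows i * d, ..., i * d + d - 1.
\<close>

section \<open>Linear algebra\<close>

definition col_mat :: "real vec \<Rightarrow> real mat" where
  "col_mat v = mat_of_cols (dim_vec v) [v]"

definition kron :: "real mat \<Rightarrow> real mat \<Rightarrow> real mat" (infixl "\<otimes>\<^sub>K" 75) where
  "A \<otimes>\<^sub>K B = mat (dim_row A * dim_row B) (dim_col A * dim_col B)
     (\<lambda>(r, c). A $$ (r div dim_row B, c div dim_col B) * B $$ (r mod dim_row B, c mod dim_col B))"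

definition sum_mat :: "nat \<Rightarrow> nat \<Rightarrow> ('a \<Rightarrow> real mat) \<Rightarrow> 'a set \<Rightarrow> real mat" where
  "sum_mat nr nc f I = mat nr nc (\<lambda>rc. \<Sum>j\<in>I. f j $$ rc)"

definition trace_mat :: "real mat \<Rightarrow> real" where
  "trace_mat A = (\<Sum>i<dim_row A. A $$ (i, i))"

definition is_mp_inverse :: "real mat \<Rightarrow> real mat \<Rightarrow> bool" where
  "is_mp_inverse A X \<longleftrightarrow>
     X \<in> carrier_mat (dim_col A) (dim_row A) \<and>
     A * X * A = A \<and> X * A * X = X \<and>
     transpose_mat (A * X) = A * X \<and> transpose_mat (X * A) = X * A"

definition mp_inverse :: "real mat \<Rightarrow> real mat" where
  "mp_inverse A = (THE X. is_mp_inverse A X)"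

text \<open>The library's \<open>orthogonal_mat\<close> does not require columns of unit length.\<close>

definition orthogonal_group :: "nat \<Rightarrow> real mat set" where
  "orthogonal_group d = {Q \<in> carrier_mat d d. transpose_mat Q * Q = 1\<^sub>m d}"

definition ones_mat :: "nat \<Rightarrow> nat \<Rightarrow> real mat" where
  "ones_mat nr nc = mat nr nc (\<lambda>_. 1)"

context vec_space
begin

definition affine_span :: "'a vec set \<Rightarrow> 'a vec set" where
  "affine_span X = {lincomb a Y | a Y. finite Y \<and> Y \<subseteq> X \<and> sum a Y = 1}"

text \<open>The dimension of a non-empty affine subspace is that of its space of directions.\<close>

definition affine_dim :: "'a vec set \<Rightarrow> nat" where
  "affine_dim W = vectorspace.dim class_ring (span_vs {v - w | v w. v \<in> W \<and> w \<in> W})"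

end

section \<open>Patch frameworks\<close>

text \<open>An edge between point k and view i is stored as the pair \<open>(k, i)\<close>.\<close>

record patch =
  npoints :: nat
  nviews :: nat
  edges :: "(nat \<times> nat) set"
  coord :: "nat \<Rightarrow> nat \<Rightarrow> real vec"

definition patch_framework :: "nat \<Rightarrow> patch \<Rightarrow> bool" where
  "patch_framework d \<Theta> \<longleftrightarrow>
     edges \<Theta> \<subseteq> {..<npoints \<Theta>} \<times> {..<nviews \<Theta>} \<and>
     (\<forall>(k, i)\<in>edges \<Theta>. coord \<Theta> k i \<in> carrier_vec d)"

abbreviation nverts :: "patch \<Rightarrow> nat" where
  "nverts \<Theta> \<equiv> npoints \<Theta> + nviews \<Theta>"

text \<open>
  Every edge is directed from its point to its view; \<open>connected\<close> of the graph library refers to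
  the underlying undirected graph.
\<close>

definition patch_graph :: "patch \<Rightarrow> nat pair_pre_digraph" where
  "patch_graph \<Theta> = \<lparr> pverts = {..<nverts \<Theta>},
                    parcs = {(k, npoints \<Theta> + i) | k i. (k, i) \<in> edges \<Theta>} \<rparr>"

definition affinely_nondegenerate :: "nat \<Rightarrow> patch \<Rightarrow> nat \<Rightarrow> bool" where
  "affinely_nondegenerate d \<Theta> i \<longleftrightarrow>
     card {k. (k, i) \<in> edges \<Theta>} \<ge> d + 1 \<and>
     vec_space.affine_dim d (vec_space.affine_span d {coord \<Theta> k i | k. (k, i) \<in> edges \<Theta>}) = d"

definition edge_vec :: "patch \<Rightarrow> nat \<Rightarrow> nat \<Rightarrow> real mat" where
  "edge_vec \<Theta> k i = col_mat (unit_vec (nverts \<Theta>) k - unit_vec (nverts \<Theta>) (npoints \<Theta> + i))"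

definition block_embed :: "nat \<Rightarrow> patch \<Rightarrow> nat \<Rightarrow> real mat" where
  "block_embed d \<Theta> i = col_mat (unit_vec (nviews \<Theta>) i) \<otimes>\<^sub>K 1\<^sub>m d"

definition laplacian :: "patch \<Rightarrow> real mat" where
  "laplacian \<Theta> = sum_mat (nverts \<Theta>) (nverts \<Theta>)
     (\<lambda>(k, i). edge_vec \<Theta> k i * transpose_mat (edge_vec \<Theta> k i)) (edges \<Theta>)"

definition B_mat :: "nat \<Rightarrow> patch \<Rightarrow> real mat" where
  "B_mat d \<Theta> = sum_mat (nviews \<Theta> * d) (nverts \<Theta>)
     (\<lambda>(k, i). block_embed d \<Theta> i * col_mat (coord \<Theta> k i) * transpose_mat (edge_vec \<Theta> k i))
     (edges \<Theta>)"

definition D_mat :: "nat \<Rightarrow> patch \<Rightarrow> real mat" where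
  "D_mat d \<Theta> = sum_mat (nviews \<Theta> * d) (nviews \<Theta> * d)
     (\<lambda>(k, i). block_embed d \<Theta> i * col_mat (coord \<Theta> k i) * transpose_mat (col_mat (coord \<Theta> k i))
               * transpose_mat (block_embed d \<Theta> i))
     (edges \<Theta>)"

definition C_mat :: "nat \<Rightarrow> patch \<Rightarrow> real mat" where
  "C_mat d \<Theta> = D_mat d \<Theta> - B_mat d \<Theta> * mp_inverse (laplacian \<Theta>) * transpose_mat (B_mat d \<Theta>)"

section \<open>Alignments\<close>

definition block :: "nat \<Rightarrow> real mat \<Rightarrow> nat \<Rightarrow> real mat" where
  "block d S i = mat d d (\<lambda>(r, c). S $$ (i * d + r, c))"

definition alignment :: "nat \<Rightarrow> patch \<Rightarrow> real mat \<Rightarrow> bool" where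
  "alignment d \<Theta> S \<longleftrightarrow>
     S \<in> carrier_mat (nviews \<Theta> * d) d \<and> (\<forall>i<nviews \<Theta>. block d S i \<in> orthogonal_group d)"

definition alignment_error :: "nat \<Rightarrow> patch \<Rightarrow> real mat \<Rightarrow> real" where
  "alignment_error d \<Theta> S = trace_mat (C_mat d \<Theta> * S * transpose_mat S)"

definition perfect_alignment :: "nat \<Rightarrow> patch \<Rightarrow> real mat \<Rightarrow> bool" where
  "perfect_alignment d \<Theta> S \<longleftrightarrow> alignment d \<Theta> S \<and> alignment_error d \<Theta> S = 0"

definition optimal_alignment :: "nat \<Rightarrow> patch \<Rightarrow> real mat \<Rightarrow> bool" where
  "optimal_alignment d \<Theta> S \<longleftrightarrow> alignment d \<Theta> S \<and>
     (\<forall>T. alignment d \<Theta> T \<longrightarrow> alignment_error d \<Theta> S \<le> alignment_error d \<Theta> T)"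

definition unique_alignment :: "nat \<Rightarrow> patch \<Rightarrow> real mat \<Rightarrow> bool" where
  "unique_alignment d \<Theta> S \<longleftrightarrow> optimal_alignment d \<Theta> S \<and>
     (\<forall>T. optimal_alignment d \<Theta> T \<and> T \<noteq> S \<longrightarrow> (\<exists>Q\<in>orthogonal_group d. T = S * Q))"

section \<open>Overlaps\<close>

text \<open>
  The rank-one correction moves the centroid of the first n columns (the points) to the origin.
\<close>

definition H_mat :: "nat \<Rightarrow> patch \<Rightarrow> real mat \<Rightarrow> real mat" where
  "H_mat d \<Theta> S = transpose_mat S * B_mat d \<Theta> * mp_inverse (laplacian \<Theta>) *
     (1\<^sub>m (nverts \<Theta>) - (1 / real (npoints \<Theta>)) \<cdot>\<^sub>m
        (col_mat (vec (nverts \<Theta>) (\<lambda>v. if v < npoints \<Theta> then 1 else 0)) *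
         transpose_mat (ones_mat (nverts \<Theta>) 1)))"

definition translation :: "nat \<Rightarrow> patch \<Rightarrow> real mat \<Rightarrow> nat \<Rightarrow> real vec" where
  "translation d \<Theta> S i = col (H_mat d \<Theta> S) (npoints \<Theta> + i)"

definition aligned_point :: "nat \<Rightarrow> patch \<Rightarrow> real mat \<Rightarrow> nat \<Rightarrow> nat \<Rightarrow> real vec" where
  "aligned_point d \<Theta> S k i =
     transpose_mat (block d S i) *\<^sub>v coord \<Theta> k i + translation d \<Theta> S i"

definition overlap_points :: "patch \<Rightarrow> nat set \<Rightarrow> nat set \<Rightarrow> nat set" where
  "overlap_points \<Theta> A B = {k. \<exists>i\<in>A. \<exists>j\<in>B. (k, i) \<in> edges \<Theta> \<and> (k, j) \<in> edges \<Theta>}"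

text \<open>
  For a perfect alignment the aligned point does not depend on the view containing it, so the choice
  of the least view of \<open>A\<close> is immaterial; it only makes the matrix well defined for every \<open>S\<close>.
\<close>

definition overlap_mat :: "nat \<Rightarrow> patch \<Rightarrow> real mat \<Rightarrow> nat set \<Rightarrow> nat set \<Rightarrow> real mat" where
  "overlap_mat d \<Theta> S A B = mat_of_cols d
     (map (\<lambda>k. aligned_point d \<Theta> S k (LEAST i. i \<in> A \<and> (k, i) \<in> edges \<Theta>))
          (sorted_list_of_set (overlap_points \<Theta> A B)))"

definition centered :: "real mat \<Rightarrow> real mat" where
  "centered M = M * (1\<^sub>m (dim_col M) - (1 / real (dim_col M)) \<cdot>\<^sub>m
     (ones_mat (dim_col M) 1 * transpose_mat (ones_mat (dim_col M) 1)))"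

end

theory Submission
  imports Defs
begin

text \<open>
  If the rank is less than \<open>d\<close>, the aligned overlap points of \<open>A\<close> and \<open>B\<close> lie on a hyperplane.
  Reflecting all views of \<open>B\<close> in it fixes the overlap points, so the new alignment still places
  every point consistently and is again perfect. It agrees with \<open>S\<close> on \<open>A\<close> but not on \<open>B\<close>, so it is
  not of the form \<open>S Q\<close>. That consistent placements are the same as a vanishing error follows
  by completing the square: the error is the sum over the edges of \<open>|T\<^sub>i\<^sup>T x + t\<^sub>i - p\<^sub>k|\<^sup>2\<close> for the optimal
  translations \<open>t\<^sub>i\<close> and positions \<open>p\<^sub>k\<close>.
\<close>

section \<open>Matrices\<close>

text \<open>The hyperplane comes from centring. A rank below \<open>d\<close> yields a vector u, not
  zero, that is orthogonal to all columns of the centred matrix, so u has the same inner product c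
  with every overlap point; u and c are the normal and the height of the mirror. An empty overlap is
  included: then any mirror serves. The mirror need not pass through the origin, whereas an
  alignment records only linear parts, so the offset has to go into the translations. The error
  hides these behind the pseudoinverse of the Laplacian, and following that pseudoinverse through
  the reflection would be awkward. Instead, any matrix of positions and translations that reproduces
  all edges is shown to certify error zero, and one is written down for the reflected alignment.
  Since \<open>mp_inverse\<close> is a definite description, its equations become available only
  once a pseudoinverse has been exhibited. Connectedness provides one, because the kernel of the
  Laplacian is then the line of constant vectors.\<close>

lemma injective_imp_inverse:
  fixes A :: "'a :: field mat"
  assumes A: "A \<in> carrier_mat n n"
    and inj: "\<And>v. v \<in> carrier_vec n \<Longrightarrow> A *\<^sub>v v = 0\<^sub>v n \<Longrightarrow> v = 0\<^sub>v n"
  obtains G where "G \<in> carrier_mat n n" "A * G = 1\<^sub>m n" "G * A = 1\<^sub>m n"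
proof -
  have "det A \<noteq> 0"
    using inj det_0_iff_vec_prod_zero_field[OF A] by blast
  then have "A \<in> Units (ring_mat TYPE('a) n ())"
    by (rule det_non_zero_imp_unit[OF A])
  then show ?thesis
    using that unfolding Units_def ring_mat_def by auto
qed

lemma scalar_prod_self_ge_0: "0 \<le> (v :: real vec) \<bullet> v"
  by (auto simp: scalar_prod_def intro!: sum_nonneg)

lemma scalar_prod_self_eq_0:
  fixes v :: "real vec"
  assumes "v \<bullet> v = 0" "v \<in> carrier_vec n"
  shows "v = 0\<^sub>v n"
  using assms by (auto simp: scalar_prod_def sum_nonneg_eq_0_iff)

lemma (in vec_space) rank_eq_n:
  assumes A: "A \<in> carrier_mat n nc"
    and surj: "\<And>w. w \<in> carrier_vec n \<Longrightarrow> \<exists>v \<in> carrier_vec nc. A *\<^sub>v v = w"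
  shows "rank A = n"
proof -
  have "span (set (cols A)) = carrier V"
    using surj A col_space_eq[OF A] unfolding col_space_def by auto
  \<comment> \<open>\<open>rank\<close> is the dimension of \<open>V\<close> with its carrier
    replaced by the column span; here the replacement changes nothing.\<close>
  moreover have "V\<lparr>carrier := carrier V\<rparr> = V"
    by simp
  ultimately show ?thesis
    unfolding rank_def using dim_is_n by metis
qed

text \<open>If no vector is orthogonal to all columns, then \<open>A A\<^sup>T\<close> is invertible.\<close>

lemma rank_less_imp_orthogonal:
  fixes A :: "real mat"
  assumes A: "A \<in> carrier_mat n nc" and rank: "vec_space.rank n A \<noteq> n"
  obtains u where "u \<in> carrier_vec n" "u \<noteq> 0\<^sub>v n" "A\<^sup>T *\<^sub>v u = 0\<^sub>v nc"
proof (rule ccontr)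
  assume "\<not> thesis"
  then have neg: "\<And>u. u \<in> carrier_vec n \<Longrightarrow> A\<^sup>T *\<^sub>v u = 0\<^sub>v nc \<Longrightarrow> u = 0\<^sub>v n"
    using that by blast
  have inj: "u = 0\<^sub>v n" if u: "u \<in> carrier_vec n" "(A * A\<^sup>T) *\<^sub>v u = 0\<^sub>v n" for u
  proof -
    have "(A\<^sup>T *\<^sub>v u) \<bullet> (A\<^sup>T *\<^sub>v u) = u \<bullet> (A *\<^sub>v (A\<^sup>T *\<^sub>v u))"
      by (rule transpose_vec_mult_scalar[OF A]) (use A u in auto)
    also have "\<dots> = 0"
      using A u by simp
    finally have "A\<^sup>T *\<^sub>v u = 0\<^sub>v nc"
      by (rule scalar_prod_self_eq_0) (use A u in auto)
    then show ?thesis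
      using neg u(1) by blast
  qed
  have AT: "A\<^sup>T \<in> carrier_mat nc n"
    using A by simp
  have AA: "A * A\<^sup>T \<in> carrier_mat n n"
    using A by simp
  then obtain G where G: "G \<in> carrier_mat n n" "A * A\<^sup>T * G = 1\<^sub>m n"
    using inj by (rule injective_imp_inverse)
  \<comment> \<open>\<open>A\<^sup>T * G\<close> is a right inverse of \<open>A\<close>, so the
    columns span the whole space.\<close>
  have "\<exists>v \<in> carrier_vec nc. A *\<^sub>v v = w" if w: "w \<in> carrier_vec n" for w
  proof
    show "A\<^sup>T *\<^sub>v (G *\<^sub>v w) \<in> carrier_vec nc"
      by (intro mult_mat_vec_carrier[OF AT] mult_mat_vec_carrier[OF G(1) w])
    have "A *\<^sub>v (A\<^sup>T *\<^sub>v (G *\<^sub>v w)) = (A * A\<^sup>T * G) *\<^sub>v w"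
      unfolding assoc_mult_mat_vec[OF AA G(1) w]
      by (rule assoc_mult_mat_vec[OF A AT mult_mat_vec_carrier[OF G(1) w], symmetric])
    then show "A *\<^sub>v (A\<^sup>T *\<^sub>v (G *\<^sub>v w)) = w"
      using G(2) w by simp
  qed
  then show False
    using rank vec_space.rank_eq_n[OF A] by blast
qed

section \<open>Column matrices and sums of outer products\<close>

lemma col_mat_carrier [simp]: "col_mat v \<in> carrier_mat (dim_vec v) 1"
  unfolding col_mat_def by (rule carrier_matI) auto

lemma index_col_mat [simp]: "a < dim_vec v \<Longrightarrow> col_mat v $$ (a, 0) = v $ a"
  by (simp add: col_mat_def mat_of_cols_def)

lemma dim_col_mat [simp]: "dim_row (col_mat v) = dim_vec v" "dim_col (col_mat v) = 1"
  by (simp_all add: col_mat_def)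

lemma minus_eq_zeroD:
  fixes v w :: "'a :: group_add vec"
  assumes "v - w = 0\<^sub>v n" "v \<in> carrier_vec n" "w \<in> carrier_vec n"
  shows "v = w"
proof (rule eq_vecI)
  fix a assume "a < dim_vec w"
  then show "v $ a = w $ a"
    using arg_cong[OF assms(1), of "\<lambda>v. v $ a"] assms(2,3) by simp
qed (use assms in auto)

lemma add_diff_add_vec:
  fixes v w z :: "'a :: ab_group_add vec"
  assumes "v \<in> carrier_vec n" "w \<in> carrier_vec n" "z \<in> carrier_vec n"
  shows "(v + z) - (w + z) = v - w"
  using assms by (intro eq_vecI) auto

lemma smult_mult_mat_vec:
  fixes A :: "'a :: comm_ring_1 mat"
  assumes "dim_col A = dim_vec v"
  shows "(a \<cdot>\<^sub>m A) *\<^sub>v v = a \<cdot>\<^sub>v (A *\<^sub>v v)"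
  using assms by (intro eq_vecI) (auto simp: scalar_prod_def sum_distrib_left mult.assoc)

text \<open>The sum of the rank-one matrices u_e v_e^T. The Laplacian, \<open>B_mat\<close> and
  \<open>D_mat\<close> all have this shape, so multiplying them by a matrix only changes the vectors
  attached to the edges.\<close>

definition outer_sum :: "nat \<Rightarrow> nat \<Rightarrow> ('e \<Rightarrow> real vec) \<Rightarrow> ('e \<Rightarrow> real vec) \<Rightarrow> 'e set \<Rightarrow> real mat"
  where "outer_sum nr nc u v E = mat nr nc (\<lambda>(a, b). \<Sum>e\<in>E. u e $ a * v e $ b)"

lemma outer_sum_carrier [simp]: "outer_sum nr nc u v E \<in> carrier_mat nr nc"
  by (simp add: outer_sum_def)

lemma sum_mat_outer:
  assumes "\<And>e. e \<in> E \<Longrightarrow> f e = col_mat (u e) * transpose_mat (col_mat (v e))"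
    and "\<And>e. e \<in> E \<Longrightarrow> u e \<in> carrier_vec nr" "\<And>e. e \<in> E \<Longrightarrow> v e \<in> carrier_vec nc"
  shows "sum_mat nr nc f E = outer_sum nr nc u v E"
  unfolding sum_mat_def outer_sum_def
proof (intro cong_mat refl)
  fix a b assume ab: "a < nr" "b < nc"
  have "f e $$ (a, b) = u e $ a * v e $ b" if e: "e \<in> E" for e
    unfolding assms(1)[OF e] using assms(2,3)[OF e] ab
    by (auto simp: scalar_prod_def)
  then show "(\<Sum>j\<in>E. f j $$ (a, b)) = (case (a, b) of (a, b) \<Rightarrow> \<Sum>e\<in>E. u e $ a * v e $ b)"
    by simp
qed

lemma transpose_outer_sum: "(outer_sum nr nc u v E)\<^sup>T = outer_sum nc nr v u E"
  by (intro eq_matI) (auto simp: outer_sum_def mult.commute)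

lemma outer_sum_cong:
  assumes "\<And>e. e \<in> E \<Longrightarrow> u e = u' e" "\<And>e. e \<in> E \<Longrightarrow> v e = v' e"
  shows "outer_sum nr nc u v E = outer_sum nr nc u' v' E"
  unfolding outer_sum_def by (intro cong_mat refl) (simp add: assms)

lemma mult_outer_sum:
  assumes P: "P \<in> carrier_mat p nr" and u: "\<And>e. e \<in> E \<Longrightarrow> u e \<in> carrier_vec nr"
  shows "P * outer_sum nr nc u v E = outer_sum p nc (\<lambda>e. P *\<^sub>v u e) v E"
proof (intro eq_matI)
  fix a b assume "a < dim_row (outer_sum p nc (\<lambda>e. P *\<^sub>v u e) v E)"
    "b < dim_col (outer_sum p nc (\<lambda>e. P *\<^sub>v u e) v E)"
  then have ab: "a < p" "b < nc"
    by (auto simp: outer_sum_def)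
  have "(P * outer_sum nr nc u v E) $$ (a, b) = (\<Sum>r<nr. P $$ (a, r) * (\<Sum>e\<in>E. u e $ r * v e $ b))"
    using P ab by (simp add: outer_sum_def scalar_prod_def lessThan_atLeast0)
  also have "\<dots> = (\<Sum>r<nr. \<Sum>e\<in>E. P $$ (a, r) * u e $ r * v e $ b)"
    by (simp add: sum_distrib_left mult.assoc)
  also have "\<dots> = (\<Sum>e\<in>E. \<Sum>r<nr. P $$ (a, r) * u e $ r * v e $ b)"
    by (rule sum.swap)
  also have "\<dots> = (\<Sum>e\<in>E. (\<Sum>r<nr. P $$ (a, r) * u e $ r) * v e $ b)"
    by (simp add: sum_distrib_right)
  also have "\<dots> = (\<Sum>e\<in>E. (P *\<^sub>v u e) $ a * v e $ b)"
    using P ab u by (intro sum.cong refl) (fastforce simp: scalar_prod_def lessThan_atLeast0)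
  finally show "(P * outer_sum nr nc u v E) $$ (a, b) = outer_sum p nc (\<lambda>e. P *\<^sub>v u e) v E $$ (a, b)"
    using ab by (simp add: outer_sum_def)
qed (use P in \<open>auto simp: outer_sum_def\<close>)

lemma outer_sum_mult:
  assumes Q: "Q \<in> carrier_mat nc q" and v: "\<And>e. e \<in> E \<Longrightarrow> v e \<in> carrier_vec nc"
  shows "outer_sum nr nc u v E * Q = outer_sum nr q u (\<lambda>e. Q\<^sup>T *\<^sub>v v e) E"
proof -
  have "(outer_sum nr nc u v E * Q)\<^sup>T = Q\<^sup>T * outer_sum nc nr v u E"
    by (subst transpose_mult[OF outer_sum_carrier Q]) (simp add: transpose_outer_sum)
  also have "\<dots> = (outer_sum nr q u (\<lambda>e. Q\<^sup>T *\<^sub>v v e) E)\<^sup>T"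
    using mult_outer_sum[of "Q\<^sup>T" q nc E v nr u] Q v by (simp add: transpose_outer_sum)
  finally show ?thesis
    by simp
qed

text \<open>The square to be completed, with matrix values, so that the mixed terms can be
  identified before any trace is taken.\<close>

lemma outer_sum_diff:
  assumes "\<And>e. e \<in> E \<Longrightarrow> u e \<in> carrier_vec n" "\<And>e. e \<in> E \<Longrightarrow> v e \<in> carrier_vec n"
  shows "outer_sum n n (\<lambda>e. u e - v e) (\<lambda>e. u e - v e) E =
    outer_sum n n u u E - outer_sum n n u v E - outer_sum n n v u E + outer_sum n n v v E"
proof (intro eq_matI)
  fix a b assume "a < dim_row (outer_sum n n u u E - outer_sum n n u v E - outer_sum n n v u E + outer_sum n n v v E)"
    "b < dim_col (outer_sum n n u u E - outer_sum n n u v E - outer_sum n n v u E + outer_sum n n v v E)"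
  then have ab: "a < n" "b < n"
    by (auto simp: outer_sum_def)
  have "(u e - v e) $ a * (u e - v e) $ b =
      u e $ a * u e $ b - u e $ a * v e $ b - v e $ a * u e $ b + v e $ a * v e $ b" if "e \<in> E" for e
    using assms[OF that] ab by (simp add: algebra_simps)
  then show "outer_sum n n (\<lambda>e. u e - v e) (\<lambda>e. u e - v e) E $$ (a, b) =
      (outer_sum n n u u E - outer_sum n n u v E - outer_sum n n v u E + outer_sum n n v v E) $$ (a, b)"
    using ab by (simp add: outer_sum_def sum_subtractf sum.distrib)
qed (auto simp: outer_sum_def)

lemma trace_outer_sum:
  assumes "\<And>e. e \<in> E \<Longrightarrow> u e \<in> carrier_vec n"
  shows "trace_mat (outer_sum n n u u E) = (\<Sum>e\<in>E. u e \<bullet> u e)"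
proof -
  have "trace_mat (outer_sum n n u u E) = (\<Sum>a<n. \<Sum>e\<in>E. u e $ a * u e $ a)"
    by (simp add: trace_mat_def outer_sum_def)
  also have "\<dots> = (\<Sum>e\<in>E. \<Sum>a<n. u e $ a * u e $ a)"
    by (rule sum.swap)
  also have "\<dots> = (\<Sum>e\<in>E. u e \<bullet> u e)"
    using assms by (intro sum.cong refl) (auto simp: scalar_prod_def lessThan_atLeast0 dest!: carrier_vecD)
  finally show ?thesis .
qed

text \<open>Used for the Laplacian: its quadratic form becomes a sum of squares over the edges, so
  its vanishing gives one equation per edge.\<close>

lemma scalar_prod_outer_sum:
  assumes w: "w \<in> carrier_vec n" and u: "\<And>e. e \<in> E \<Longrightarrow> u e \<in> carrier_vec n"
  shows "w \<bullet> (outer_sum n n u u E *\<^sub>v w) = (\<Sum>e\<in>E. (u e \<bullet> w)\<^sup>2)"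
proof -
  have "w \<bullet> (outer_sum n n u u E *\<^sub>v w) =
      (\<Sum>a<n. \<Sum>b<n. \<Sum>e\<in>E. (u e $ a * w $ a) * (u e $ b * w $ b))"
  proof -
    have "w \<bullet> (outer_sum n n u u E *\<^sub>v w) =
        (\<Sum>a<n. w $ a * (\<Sum>b<n. (\<Sum>e\<in>E. u e $ a * u e $ b) * w $ b))"
      using w by (simp add: scalar_prod_def lessThan_atLeast0 outer_sum_def)
    then show ?thesis
      by (simp only: sum_distrib_left sum_distrib_right mult_ac)
  qed
  also have "\<dots> = (\<Sum>a<n. \<Sum>e\<in>E. \<Sum>b<n. (u e $ a * w $ a) * (u e $ b * w $ b))"
    by (intro sum.cong refl sum.swap)
  also have "\<dots> = (\<Sum>e\<in>E. \<Sum>a<n. \<Sum>b<n. (u e $ a * w $ a) * (u e $ b * w $ b))"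
    by (rule sum.swap)
  also have "\<dots> = (\<Sum>e\<in>E. (\<Sum>a<n. u e $ a * w $ a)\<^sup>2)"
    by (simp add: power2_eq_square sum_product)
  also have "\<dots> = (\<Sum>e\<in>E. (u e \<bullet> w)\<^sup>2)"
    using w by (simp add: scalar_prod_def lessThan_atLeast0)
  finally show ?thesis .
qed

section \<open>Trace, pseudoinverse and centring\<close>

lemma trace_mult_comm:
  assumes "A \<in> carrier_mat n k" "B \<in> carrier_mat k n"
  shows "trace_mat (A * B) = trace_mat (B * A)"
proof -
  have "trace_mat (A * B) = (\<Sum>i<n. \<Sum>j<k. A $$ (i, j) * B $$ (j, i))"
    using assms by (simp add: trace_mat_def scalar_prod_def lessThan_atLeast0)
  also have "\<dots> = (\<Sum>j<k. \<Sum>i<n. B $$ (j, i) * A $$ (i, j))"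
    by (subst sum.swap) (simp add: mult.commute)
  also have "\<dots> = trace_mat (B * A)"
    using assms by (simp add: trace_mat_def scalar_prod_def lessThan_atLeast0)
  finally show ?thesis .
qed

text \<open>Uniqueness of the pseudoinverse. Transposing (A X)(A Y) = A Y, where both factors are
  symmetric, gives A Y = A X, and likewise Y A = X A. Then Y = Y A Y = X A Y = X A X = X.\<close>

lemma mp_inverse_eqI:
  assumes X: "is_mp_inverse A X"
  shows "mp_inverse A = X"
  unfolding mp_inverse_def
proof (rule the_equality[of "is_mp_inverse A", OF X])
  fix Y assume Y: "is_mp_inverse A Y"
  define n k where "n = dim_row A" and "k = dim_col A"
  have c: "A \<in> carrier_mat n k" "X \<in> carrier_mat k n" "Y \<in> carrier_mat k n"
    using X Y unfolding is_mp_inverse_def n_def k_def by auto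
  have x: "A * X * A = A" "X * A * X = X" "(A * X)\<^sup>T = A * X" "(X * A)\<^sup>T = X * A"
    using X unfolding is_mp_inverse_def by auto
  have y: "A * Y * A = A" "Y * A * Y = Y" "(A * Y)\<^sup>T = A * Y" "(Y * A)\<^sup>T = Y * A"
    using Y unfolding is_mp_inverse_def by auto
  have p: "A * X \<in> carrier_mat n n" "A * Y \<in> carrier_mat n n"
    "X * A \<in> carrier_mat k k" "Y * A \<in> carrier_mat k k"
    using c by auto
  have 1: "A * X * (A * Y) = A * Y" "A * Y * (A * X) = A * X"
    using assoc_mult_mat[OF p(1) c(1,3)] assoc_mult_mat[OF p(2) c(1,2)] x(1) y(1) by simp_all
  have "A * Y = (A * X * (A * Y))\<^sup>T"
    using 1 y(3) by simp
  also have "\<dots> = A * X"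
    unfolding transpose_mult[OF p(1,2)] x(3) y(3) by (rule 1)
  finally have AY: "A * Y = A * X" .
  have 2: "X * A * (Y * A) = X * A" "Y * A * (X * A) = Y * A"
    using assoc_mult_mat[OF c(2,1) p(4)] assoc_mult_mat[OF c(3,1) p(3)]
      assoc_mult_mat[OF c(1,3,1)] assoc_mult_mat[OF c(1,2,1)] x(1) y(1) by simp_all
  have "Y * A = (Y * A * (X * A))\<^sup>T"
    using 2 y(4) by simp
  also have "\<dots> = X * A"
    unfolding transpose_mult[OF p(4,3)] x(4) y(4) by (rule 2)
  finally have YA: "Y * A = X * A" .
  have "Y = X * A * Y"
    using y(2) YA by simp
  also have "\<dots> = X * (A * X)"
    using assoc_mult_mat[OF c(2,1,3)] AY by simp
  also have "\<dots> = X"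
    using assoc_mult_mat[OF c(2,1,2)] x(2) by simp
  finally show "Y = X" .
qed

text \<open>Centring is multiplication by a symmetric matrix \<open>W\<close>, so the hypothesis
  says \<open>W\<close> annihilates p = \<open>M\<^sup>T\<close> u. Since \<open>W\<close> subtracts
  the mean, every entry of p equals the mean of p; this mean is the height c.\<close>

lemma centered_orthogonal:
  assumes M: "M \<in> carrier_mat d q" and u: "u \<in> carrier_vec d"
    and orth: "(centered M)\<^sup>T *\<^sub>v u = 0\<^sub>v q"
  obtains c where "\<And>j. j < q \<Longrightarrow> u \<bullet> col M j = c"
proof -
  define p where "p = M\<^sup>T *\<^sub>v u"
  define J where "J = ones_mat q 1 * (ones_mat q 1)\<^sup>T"
  define W where "W = 1\<^sub>m q - (1 / real q) \<cdot>\<^sub>m J"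
  have J_eq: "J = mat q q (\<lambda>_. 1)"
    by (intro eq_matI) (auto simp: J_def ones_mat_def scalar_prod_def)
  have J: "J \<in> carrier_mat q q"
    by (simp add: J_eq)
  have W: "W \<in> carrier_mat q q"
    unfolding W_def by (intro minus_carrier_mat smult_carrier_mat J)
  have WT: "W\<^sup>T = W"
    unfolding W_def J_eq by (intro eq_matI) auto
  have p: "p \<in> carrier_vec q"
    using M unfolding p_def by (auto intro!: carrier_vecI)
  have "centered M = M * W"
    using M unfolding centered_def W_def J_def by simp
  then have "W *\<^sub>v p = 0\<^sub>v q"
    using orth transpose_mult[OF M W] WT assoc_mult_mat_vec[OF W, of "M\<^sup>T" d u] M u
    by (simp add: p_def)
  moreover have "W *\<^sub>v p = p - (1 / real q) \<cdot>\<^sub>v (J *\<^sub>v p)"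
    unfolding W_def using J p
    by (subst minus_mult_distrib_mat_vec[of _ q q]) (simp_all add: smult_mult_mat_vec)
  ultimately have "p - (1 / real q) \<cdot>\<^sub>v (J *\<^sub>v p) = 0\<^sub>v q"
    by (simp only:)
  then have eq: "p = (1 / real q) \<cdot>\<^sub>v (J *\<^sub>v p)"
    by (rule minus_eq_zeroD[OF _ p smult_carrier_vec[THEN iffD2, OF mult_mat_vec_carrier[OF J p]]])
  have "u \<bullet> col M j = (1 / real q) * (\<Sum>l<q. p $ l)" if j: "j < q" for j
  proof -
    have "u \<bullet> col M j = p $ j"
      using M u j by (auto simp: p_def intro: comm_scalar_prod[of _ d])
    also have "\<dots> = ((1 / real q) \<cdot>\<^sub>v (J *\<^sub>v p)) $ j"
      by (rule arg_cong[OF eq])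
    also have "\<dots> = (1 / real q) * (\<Sum>l<q. p $ l)"
      using p j by (simp add: J_eq scalar_prod_def lessThan_atLeast0)
    finally show ?thesis .
  qed
  then show ?thesis
    by (rule that)
qed

section \<open>Orthogonal matrices\<close>

text \<open>The Householder matrix: the linear reflection in the hyperplane through the origin with
  normal u, where u need not have unit length.\<close>

definition reflection :: "nat \<Rightarrow> real vec \<Rightarrow> real mat" where
  "reflection d u = mat d d (\<lambda>(a, b). (if a = b then 1 else 0) - 2 / (u \<bullet> u) * u $ a * u $ b)"

lemma reflection_carrier [simp]: "reflection d u \<in> carrier_mat d d"
  by (simp add: reflection_def)

lemma transpose_reflection: "(reflection d u)\<^sup>T = reflection d u"
  by (intro eq_matI) (auto simp: reflection_def)

lemma reflection_mult_vec:
  assumes u: "u \<in> carrier_vec d" and x: "x \<in> carrier_vec d"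
  shows "reflection d u *\<^sub>v x = x - (2 / (u \<bullet> u) * (u \<bullet> x)) \<cdot>\<^sub>v u"
proof (rule eq_vecI)
  fix a assume "a < dim_vec (x - (2 / (u \<bullet> u) * (u \<bullet> x)) \<cdot>\<^sub>v u)"
  then have a: "a < d"
    using u by simp
  have "(reflection d u *\<^sub>v x) $ a =
      (\<Sum>c<d. ((if a = c then 1 else 0) - 2 / (u \<bullet> u) * u $ a * u $ c) * x $ c)"
    using x a by (simp add: reflection_def scalar_prod_def[of _ x] lessThan_atLeast0)
  also have "\<dots> = (\<Sum>c<d. (if a = c then x $ c else 0) - 2 / (u \<bullet> u) * u $ a * (u $ c * x $ c))"
    by (intro sum.cong) (auto simp: algebra_simps)
  also have "\<dots> = x $ a - 2 / (u \<bullet> u) * u $ a * (\<Sum>c<d. u $ c * x $ c)"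
    using a by (simp add: sum_subtractf sum_distrib_left)
  also have "(\<Sum>c<d. u $ c * x $ c) = u \<bullet> x"
    using x by (simp add: scalar_prod_def lessThan_atLeast0)
  finally show "(reflection d u *\<^sub>v x) $ a = (x - (2 / (u \<bullet> u) * (u \<bullet> x)) \<cdot>\<^sub>v u) $ a"
    using u x a by (simp add: mult_ac)
qed (use u in \<open>simp add: reflection_def\<close>)

lemma reflection_orthogonal:
  assumes u: "u \<in> carrier_vec d" "u \<noteq> 0\<^sub>v d"
  shows "reflection d u \<in> orthogonal_group d"
proof -
  let ?R = "reflection d u" and ?t = "2 / (u \<bullet> u)"
  \<comment> \<open>As \<open>?R\<close> is symmetric, orthogonality amounts to being an involution,
    which is checked column by column.\<close>
  have "?R * ?R = 1\<^sub>m d"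
  proof (rule eq_matI)
    fix a c assume "a < dim_row (1\<^sub>m d :: real mat)" "c < dim_col (1\<^sub>m d :: real mat)"
    then have a: "a < d" and c: "c < d"
      by auto
    let ?x = "col ?R c"
    have x: "?x = unit_vec d c - (?t * u $ c) \<cdot>\<^sub>v u"
      using u(1) c by (intro eq_vecI) (auto simp: reflection_def unit_vec_def)
    have "u \<bullet> ?x = u $ c - (?t * u $ c) * (u \<bullet> u)"
      unfolding x using u(1) c by (subst scalar_prod_minus_distrib[of _ d]) auto
    also have "\<dots> = - u $ c"
      using u scalar_prod_self_eq_0[of u d] by auto
    finally have ux: "u \<bullet> ?x = - u $ c" .
    have "(?R * ?R) $$ (a, c) = (?R *\<^sub>v ?x) $ a"
      using a c by (simp add: carrier_matD[OF reflection_carrier])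
    also have "\<dots> = (?x - (?t * (u \<bullet> ?x)) \<cdot>\<^sub>v u) $ a"
      by (subst reflection_mult_vec[OF u(1)]) (rule carrier_vecI, simp_all add: carrier_matD[OF reflection_carrier])
    also have "\<dots> = (1\<^sub>m d) $$ (a, c)"
      unfolding ux unfolding x using a c u(1) by (simp add: unit_vec_def)
    finally show "(?R * ?R) $$ (a, c) = (1\<^sub>m d) $$ (a, c)" .
  qed (auto simp: reflection_def)
  then show ?thesis
    by (simp add: orthogonal_group_def transpose_reflection)
qed

lemma reflection_ne_one:
  assumes u: "u \<in> carrier_vec d" "u \<noteq> 0\<^sub>v d"
  shows "reflection d u \<noteq> 1\<^sub>m d"
proof
  assume "reflection d u = 1\<^sub>m d"
  then have eq: "u = u - (2 / (u \<bullet> u) * (u \<bullet> u)) \<cdot>\<^sub>v u"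
    using reflection_mult_vec[OF u(1) u(1)] u(1) by simp
  have "u \<bullet> u \<noteq> 0"
    using u scalar_prod_self_eq_0 by blast
  then have "u $ a = 0" if "a < d" for a
    using arg_cong[OF eq, of "\<lambda>v. v $ a"] that u(1) by simp
  then show False
    using u by auto
qed

section \<open>The orthogonal group and blocks of stacked matrices\<close>

lemma orthogonal_group_mult:
  assumes "U \<in> orthogonal_group d" "V \<in> orthogonal_group d"
  shows "U * V \<in> orthogonal_group d"
proof -
  have c: "U \<in> carrier_mat d d" "V \<in> carrier_mat d d"
    and o: "U\<^sup>T * U = 1\<^sub>m d" "V\<^sup>T * V = 1\<^sub>m d"
    using assms unfolding orthogonal_group_def by auto
  have T: "U\<^sup>T \<in> carrier_mat d d" "V\<^sup>T \<in> carrier_mat d d"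
    using c by auto
  have "(U * V)\<^sup>T * (U * V) = V\<^sup>T * (U\<^sup>T * (U * V))"
    unfolding transpose_mult[OF c] by (rule assoc_mult_mat[OF T(2,1) mult_carrier_mat[OF c]])
  also have "\<dots> = 1\<^sub>m d"
    using assoc_mult_mat[OF T(1) c] o c by simp
  finally show ?thesis
    using c unfolding orthogonal_group_def by simp
qed

text \<open>Multiply by \<open>U\<^sup>T\<close> from the left. Thus a single view already
  determines the \<open>Q\<close> that relates two alignments.\<close>

lemma orthogonal_group_cancel:
  assumes "U \<in> orthogonal_group d" and Q: "Q \<in> carrier_mat d d" and "U * Q = U"
  shows "Q = 1\<^sub>m d"
proof -
  have c: "U \<in> carrier_mat d d" "U\<^sup>T \<in> carrier_mat d d" and o: "U\<^sup>T * U = 1\<^sub>m d"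
    using assms unfolding orthogonal_group_def by auto
  show ?thesis
    using assoc_mult_mat[OF c(2,1) Q] o assms(3) Q by simp
qed

lemma block_carrier [simp]: "block d T i \<in> carrier_mat d d"
  by (simp add: block_def)

lemma block_index_less:
  assumes "i < m" "r < d"
  shows "i * d + r < m * (d :: nat)"
proof -
  have "i * d + r < Suc i * d"
    using assms(2) by simp
  also have "\<dots> \<le> m * d"
    using assms(1) by (intro mult_le_mono1) simp
  finally show ?thesis .
qed

lemma block_mult:
  assumes "T \<in> carrier_mat (m * d) d" "Q \<in> carrier_mat d d" "i < m"
  shows "block d (T * Q) i = block d T i * Q"
proof (rule eq_matI)
  fix r c assume "r < dim_row (block d T i * Q)" "c < dim_col (block d T i * Q)"
  then have r: "r < d" and c: "c < d"
    using assms(2) by (auto simp: block_def)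
  then show "block d (T * Q) i $$ (r, c) = (block d T i * Q) $$ (r, c)"
    using assms block_index_less[OF assms(3) r] by (simp add: block_def scalar_prod_def)
qed (use assms in \<open>auto simp: block_def\<close>)

section \<open>The error of an alignment\<close>

text \<open>The values of f agree across each edge in both directions, hence along every walk of the
  symmetrised graph.\<close>

lemma connected_imp_constant:
  assumes "connected (with_proj (patch_graph \<Theta>))"
    and f: "\<And>k i. (k, i) \<in> edges \<Theta> \<Longrightarrow> f k = f (npoints \<Theta> + i)"
    and "a < nverts \<Theta>" "b < nverts \<Theta>"
  shows "f a = f b"
proof -
  let ?G = "mk_symmetric (with_proj (patch_graph \<Theta>))"
  have "(a, b) \<in> rtrancl_on (verts (with_proj ?G)) (arcs_ends (with_proj ?G))"
    using assms(1,3,4) unfolding connected_def strongly_connected_def reachable_def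
    by (auto simp: patch_graph_def)
  then show ?thesis
  proof (induction rule: rtrancl_on_induct)
    case (step y z)
    then have "f y = f z"
      using f by (fastforce simp: arcs_ends_def arc_to_ends_def parcs_mk_symmetric patch_graph_def)
    then show ?case
      using step by simp
  qed simp
qed

section \<open>Edge vectors and stacked coordinates\<close>

definition edge_diff :: "patch \<Rightarrow> nat \<times> nat \<Rightarrow> real vec" where
  "edge_diff \<Theta> = (\<lambda>(k, i). unit_vec (nverts \<Theta>) k - unit_vec (nverts \<Theta>) (npoints \<Theta> + i))"

text \<open>This is the vector (eps_i (x) I) x_{k,i}; indexing by \<open>div\<close> and
  \<open>mod\<close> removes the Kronecker product.\<close>

definition stacked_coord :: "nat \<Rightarrow> patch \<Rightarrow> nat \<times> nat \<Rightarrow> real vec" where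
  "stacked_coord d \<Theta> = (\<lambda>(k, i). vec (nviews \<Theta> * d)
     (\<lambda>a. if a div d = i then coord \<Theta> k i $ (a mod d) else 0))"

lemma edge_diff_carrier [simp]: "edge_diff \<Theta> e \<in> carrier_vec (nverts \<Theta>)"
  by (cases e) (simp add: edge_diff_def)

lemma stacked_coord_carrier [simp]: "stacked_coord d \<Theta> e \<in> carrier_vec (nviews \<Theta> * d)"
  by (cases e) (simp add: stacked_coord_def)

lemma edge_vec_eq: "edge_vec \<Theta> k i = col_mat (edge_diff \<Theta> (k, i))"
  by (simp add: edge_vec_def edge_diff_def)

lemma mult_edge_diff:
  assumes "M \<in> carrier_mat r (nverts \<Theta>)" "k < npoints \<Theta>" "i < nviews \<Theta>"
  shows "M *\<^sub>v edge_diff \<Theta> (k, i) = col M k - col M (npoints \<Theta> + i)"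
proof -
  have "M *\<^sub>v unit_vec (nverts \<Theta>) v = col M v" if "v < nverts \<Theta>" for v
    using assms(1) that by (intro eq_vecI) auto
  then show ?thesis
    using assms unfolding edge_diff_def by (simp add: mult_minus_distrib_mat_vec[OF assms(1)])
qed

lemma scalar_prod_edge_diff:
  assumes "w \<in> carrier_vec (nverts \<Theta>)" "k < npoints \<Theta>" "i < nviews \<Theta>"
  shows "edge_diff \<Theta> (k, i) \<bullet> w = w $ k - w $ (npoints \<Theta> + i)"
  using assms unfolding edge_diff_def by (simp add: minus_scalar_prod_distrib[of _ "nverts \<Theta>"])

lemma block_embed_mult:
  assumes "coord \<Theta> k i \<in> carrier_vec d" "i < nviews \<Theta>"
  shows "block_embed d \<Theta> i * col_mat (coord \<Theta> k i) = col_mat (stacked_coord d \<Theta> (k, i))"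
proof (intro eq_matI)
  fix a b assume "a < dim_row (col_mat (stacked_coord d \<Theta> (k, i)))"
    "b < dim_col (col_mat (stacked_coord d \<Theta> (k, i)))"
  then have a: "a < nviews \<Theta> * d" "b = 0"
    by (auto simp: stacked_coord_def)
  then have d: "0 < d" "a div d < nviews \<Theta>"
    by (cases d; auto simp: less_mult_imp_div_less)+
  have "(block_embed d \<Theta> i * col_mat (coord \<Theta> k i)) $$ (a, b) =
      (\<Sum>c<d. (if a div d = i then 1 else 0) * (if a mod d = c then 1 else 0) * coord \<Theta> k i $ c)"
    using assms a d by (simp add: block_embed_def kron_def scalar_prod_def lessThan_atLeast0)
  also have "\<dots> = (\<Sum>c<d. if a mod d = c then (if a div d = i then coord \<Theta> k i $ c else 0) else 0)"
    by (intro sum.cong) auto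
  also have "\<dots> = (if a div d = i then coord \<Theta> k i $ (a mod d) else 0)"
    using d by simp
  finally show "(block_embed d \<Theta> i * col_mat (coord \<Theta> k i)) $$ (a, b) =
      col_mat (stacked_coord d \<Theta> (k, i)) $$ (a, b)"
    using a by (simp add: stacked_coord_def)
qed (use assms in \<open>auto simp: block_embed_def kron_def stacked_coord_def\<close>)

lemma sum_block:
  fixes f :: "nat \<Rightarrow> 'a :: comm_monoid_add"
  assumes "i < m" and zero: "\<And>a. a < m * d \<Longrightarrow> a div d \<noteq> i \<Longrightarrow> f a = 0"
  shows "(\<Sum>a<m * d. f a) = (\<Sum>r<d. f (i * d + r))"
proof -
  have le: "i * d + d \<le> m * d"
    using assms(1) by (metis Suc_leI add.commute mult_Suc mult_le_mono1)
  have img: "(\<lambda>r. i * d + r) ` {..<d} = {a. a < m * d \<and> a div d = i}" (is "?l = ?r")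
  proof (intro subset_antisym subsetI)
    fix a assume "a \<in> ?r"
    then have "a = i * d + a mod d" "0 < d"
      using div_mult_mod_eq[of a d] by (auto intro!: gr0I)
    then show "a \<in> ?l"
      using mod_less_divisor[of d a] by blast
  next
    fix a assume "a \<in> ?l"
    then obtain r where "a = i * d + r" "r < d"
      by blast
    then show "a \<in> ?r"
      using le by simp
  qed
  have "(\<Sum>r<d. f (i * d + r)) = sum f ((\<lambda>r. i * d + r) ` {..<d})"
    by (subst sum.reindex) (auto simp: inj_on_def)
  also have "\<dots> = (\<Sum>a<m * d. f a)"
    unfolding img using zero by (intro sum.mono_neutral_left) auto
  finally show ?thesis
    by simp
qed

text \<open>Only the rows of \<open>T\<close> in block i meet the support of
  \<open>stacked_coord\<close>. This gives the matrix expressions in the error their geometric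
  meaning: a local point as turned by its view.\<close>

lemma transpose_mult_stacked_coord:
  assumes T: "T \<in> carrier_mat (nviews \<Theta> * d) d"
    and "coord \<Theta> k i \<in> carrier_vec d" "i < nviews \<Theta>"
  shows "T\<^sup>T *\<^sub>v stacked_coord d \<Theta> (k, i) = (block d T i)\<^sup>T *\<^sub>v coord \<Theta> k i"
proof (intro eq_vecI)
  fix c assume "c < dim_vec ((block d T i)\<^sup>T *\<^sub>v coord \<Theta> k i)"
  then have c: "c < d"
    by (simp add: block_def)
  have "(T\<^sup>T *\<^sub>v stacked_coord d \<Theta> (k, i)) $ c =
      (\<Sum>a<nviews \<Theta> * d. T $$ (a, c) * (if a div d = i then coord \<Theta> k i $ (a mod d) else 0))"
    using T c by (simp add: scalar_prod_def lessThan_atLeast0 stacked_coord_def)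
  also have "\<dots> = (\<Sum>r<d. T $$ (i * d + r, c) * coord \<Theta> k i $ r)"
    by (subst sum_block[OF assms(3)]) auto
  also have "\<dots> = ((block d T i)\<^sup>T *\<^sub>v coord \<Theta> k i) $ c"
    using assms c by (simp add: scalar_prod_def lessThan_atLeast0 block_def)
  finally show "(T\<^sup>T *\<^sub>v stacked_coord d \<Theta> (k, i)) $ c = ((block d T i)\<^sup>T *\<^sub>v coord \<Theta> k i) $ c" .
qed (use T in \<open>auto simp: block_def\<close>)

section \<open>The Laplacian of a connected framework and its pseudoinverse\<close>

locale connected_patch =
  fixes d :: nat and \<Theta> :: patch
  assumes framework: "patch_framework d \<Theta>"
    and conn: "connected (with_proj (patch_graph \<Theta>))"
begin

abbreviation "n \<equiv> npoints \<Theta>"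
abbreviation "m \<equiv> nviews \<Theta>"
abbreviation "N \<equiv> nverts \<Theta>"
abbreviation "E \<equiv> edges \<Theta>"
abbreviation "L \<equiv> laplacian \<Theta>"
abbreviation "L\<^sub>i \<equiv> mp_inverse (laplacian \<Theta>)"
abbreviation "g \<equiv> edge_diff \<Theta>"
abbreviation "b \<equiv> stacked_coord d \<Theta>"

lemma edgeD:
  assumes "(k, i) \<in> E"
  shows "k < n" "i < m" "coord \<Theta> k i \<in> carrier_vec d"
  using assms framework unfolding patch_framework_def by auto

lemma finite_edges: "finite E"
  using framework finite_subset unfolding patch_framework_def by blast

lemma laplacian_eq: "L = outer_sum N N g g E"
  unfolding laplacian_def by (rule sum_mat_outer) (auto simp: edge_vec_eq)

lemma B_mat_eq: "B_mat d \<Theta> = outer_sum (m * d) N b g E"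
  unfolding B_mat_def by (rule sum_mat_outer) (auto simp: edge_vec_eq block_embed_mult edgeD)

lemma D_mat_eq: "D_mat d \<Theta> = outer_sum (m * d) (m * d) b b E"
  unfolding D_mat_def
proof (rule sum_mat_outer)
  fix e assume e: "e \<in> E"
  obtain k i where ki: "e = (k, i)"
    by fastforce
  let ?M = "block_embed d \<Theta> i" and ?x = "col_mat (coord \<Theta> k i)"
  have c: "?M \<in> carrier_mat (m * d) d" "?x \<in> carrier_mat d 1"
    using edgeD[of k i] e ki by (auto simp: block_embed_def kron_def intro!: carrier_matI)
  have "?M * ?x * ?x\<^sup>T * ?M\<^sup>T = (?M * ?x) * (?M * ?x)\<^sup>T"
    unfolding transpose_mult[OF c]
    by (rule assoc_mult_mat[of _ "m * d" 1 _ d _ "m * d"]) (use c in auto)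
  then show "(case e of (k, i) \<Rightarrow> block_embed d \<Theta> i * col_mat (coord \<Theta> k i) *
      (col_mat (coord \<Theta> k i))\<^sup>T * (block_embed d \<Theta> i)\<^sup>T) = col_mat (b e) * (col_mat (b e))\<^sup>T"
    using edgeD[of k i] e ki by (simp add: block_embed_mult)
qed auto

text \<open>The quadratic form sums the squared differences of v along the edges. If it vanishes, v
  agrees at the ends of each edge and is constant by connectedness.\<close>

lemma laplacian_kernel:
  assumes v: "v \<in> carrier_vec N" and "v \<bullet> (L *\<^sub>v v) = 0" and "x < N" "y < N"
  shows "v $ x = v $ y"
proof (rule connected_imp_constant[OF conn, where f = "($) v"])
  fix k i assume e: "(k, i) \<in> E"
  have "(\<Sum>e\<in>E. (g e \<bullet> v)\<^sup>2) = 0"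
    using assms scalar_prod_outer_sum[OF v, of E g] by (simp add: laplacian_eq)
  then have "g (k, i) \<bullet> v = 0"
    using e finite_edges by (simp add: sum_nonneg_eq_0_iff)
  then show "v $ k = v $ (n + i)"
    using scalar_prod_edge_diff[OF v] edgeD[OF e] by simp
qed (use assms in auto)

text \<open>Connectedness in the graph theory excludes the empty graph. The projection onto the
  constants divides by \<open>N\<close>.\<close>

lemma N_pos: "0 < N"
  using conn unfolding connected_def strongly_connected_def
  by (auto simp: patch_graph_def intro!: gr0I)

text \<open>With \<open>P\<close> the projection onto the constant vectors, which span the kernel of the Laplacian,
  the pseudoinverse is \<open>(L + P)\<^sup>-\<^sup>1 - P\<close>.\<close>

lemma mp_inverse_laplacian:
  shows "L\<^sub>i \<in> carrier_mat N N" "L\<^sub>i\<^sup>T = L\<^sub>i" "L * L\<^sub>i * L = L" "L\<^sub>i * L * L\<^sub>i = L\<^sub>i"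
proof -
  define P where "P = mat N N (\<lambda>_. 1 / real N)"
  define M where "M = L + P"
  have L: "L \<in> carrier_mat N N" and P: "P \<in> carrier_mat N N" and M: "M \<in> carrier_mat N N"
    by (simp_all add: laplacian_eq P_def M_def)
  have LT: "L\<^sup>T = L" and PT: "P\<^sup>T = P"
    by (auto simp: laplacian_eq transpose_outer_sum P_def)
  have MT: "M\<^sup>T = M"
    using LT PT transpose_add[OF L P] by (simp add: M_def)
  have PP: "P * P = P"
    using N_pos by (intro eq_matI) (auto simp: P_def scalar_prod_def)
  \<comment> \<open>The columns of \<open>P\<close> coincide, so \<open>P\<close> annihilates every
    difference of two unit vectors; this yields \<open>P * L = 0\<close>.\<close>
  have "P *\<^sub>v g e = 0\<^sub>v N" if "e \<in> E" for e
  proof -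
    obtain k i where e: "e = (k, i)"
      by fastforce
    have "P *\<^sub>v g e = col P k - col P (n + i)"
      using mult_edge_diff[OF P] edgeD[of k i] that e by simp
    also have "\<dots> = 0\<^sub>v N"
      using edgeD[of k i] that e by (intro eq_vecI) (auto simp: P_def)
    finally show ?thesis .
  qed
  then have "P * L = outer_sum N N (\<lambda>_. 0\<^sub>v N) g E"
    unfolding laplacian_eq by (subst mult_outer_sum[OF P]) (auto intro: outer_sum_cong)
  also have "\<dots> = 0\<^sub>m N N"
    by (intro eq_matI) (auto simp: outer_sum_def)
  finally have PL: "P * L = 0\<^sub>m N N" .
  have LP: "L * P = 0\<^sub>m N N"
    using arg_cong[OF PL, of transpose_mat] transpose_mult[OF P L] LT PT by simp
  have PM: "P * M = P"
    unfolding M_def using mult_add_distrib_mat[OF P L P] PL PP P by simp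
  have MP: "M * P = P"
    unfolding M_def using add_mult_distrib_mat[OF L P P] LP PP P by simp
  \<comment> \<open>Applying \<open>P\<close> to M v = 0 gives P v = 0, hence L v = 0. So v is
    constant with mean zero.\<close>
  have "v = 0\<^sub>v N" if v: "v \<in> carrier_vec N" and Mv: "M *\<^sub>v v = 0\<^sub>v N" for v
  proof -
    have "P *\<^sub>v v = P *\<^sub>v (M *\<^sub>v v)"
      using assoc_mult_mat_vec[OF P M v] PM by simp
    also have "\<dots> = 0\<^sub>v N"
      unfolding Mv using P by (intro eq_vecI) auto
    finally have Pv: "P *\<^sub>v v = 0\<^sub>v N" .
    then have Lv: "L *\<^sub>v v = 0\<^sub>v N"
      using Mv add_mult_distrib_mat_vec[OF L P v] L v by (simp add: M_def)
    have const: "v $ a = v $ a'" if "a < N" "a' < N" for a a'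
      by (rule laplacian_kernel[OF v _ that]) (use Lv v in simp)
    have "v $ a = 0" if a: "a < N" for a
    proof -
      have "(P *\<^sub>v v) $ a = (\<Sum>j<N. 1 / real N * v $ j)"
        using v a by (simp add: P_def scalar_prod_def lessThan_atLeast0)
      also have "\<dots> = (\<Sum>j<N. 1 / real N * v $ a)"
        by (intro sum.cong refl arg_cong[where f = "\<lambda>z. 1 / real N * z"] const a) simp
      also have "\<dots> = v $ a"
        using N_pos by (simp del: of_nat_add)
      finally show ?thesis
        using Pv a by simp
    qed
    then show ?thesis
      using v by (intro eq_vecI) auto
  qed
  then obtain G where G: "G \<in> carrier_mat N N" and MG: "M * G = 1\<^sub>m N" and GM: "G * M = 1\<^sub>m N"
    using injective_imp_inverse[OF M] by blast
  have GT: "G\<^sup>T = G"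
  proof -
    have GTM: "G\<^sup>T * M = 1\<^sub>m N"
      using arg_cong[OF MG, of transpose_mat] transpose_mult[OF M G] MT by simp
    have "G\<^sup>T = G\<^sup>T * (M * G)"
      using MG G by simp
    also have "\<dots> = G"
      using assoc_mult_mat[of "G\<^sup>T" N N M N G N] GTM G M by simp
    finally show ?thesis .
  qed
  have PG: "P * G = P"
    using assoc_mult_mat[OF P M G] PM MG P by simp
  have GP: "G * P = P"
    using assoc_mult_mat[OF G M P] MP GM P by simp
  have L_eq: "L = M - P"
    unfolding M_def using L P by (intro eq_matI) auto
  define X where "X = G - P"
  have X: "X \<in> carrier_mat N N"
    unfolding X_def by (rule minus_carrier_mat[OF P])
  have XT: "X\<^sup>T = X"
    using transpose_minus[OF G P] GT PT by (simp add: X_def)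
  \<comment> \<open>Expanding (M - P)(G - P) leaves 1 - P - (P - P), because \<open>M * P\<close>,
    \<open>P * G\<close> and \<open>P * P\<close> all equal \<open>P\<close>; the product in the
    other order behaves alike.\<close>
  have cancel: "1\<^sub>m N - P - (P - P) = 1\<^sub>m N - P"
    using P by (intro eq_matI) auto
  have LX: "L * X = 1\<^sub>m N - P"
    unfolding L_eq X_def
    using minus_mult_distrib_mat[OF M P minus_carrier_mat[OF P, of G]]
      mult_minus_distrib_mat[OF M G P] mult_minus_distrib_mat[OF P G P]
      MG MP PG PP cancel by simp
  have XL: "X * L = 1\<^sub>m N - P"
    unfolding L_eq X_def
    using minus_mult_distrib_mat[OF G P minus_carrier_mat[OF P, of M]]
      mult_minus_distrib_mat[OF G M P] mult_minus_distrib_mat[OF P M P]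
      GM GP PM PP cancel by simp
  have PX: "P * X = 0\<^sub>m N N"
    unfolding X_def using mult_minus_distrib_mat[OF P G P] PG PP P by simp
  have minus_0: "Z - 0\<^sub>m N N = Z" if "Z \<in> carrier_mat N N" for Z :: "real mat"
    using that by (intro eq_matI) auto
  have 1: "L * X * L = L"
    unfolding LX using minus_mult_distrib_mat[OF one_carrier_mat P L] PL L minus_0[OF L] by simp
  have 2: "X * L * X = X"
    unfolding XL using minus_mult_distrib_mat[OF one_carrier_mat P X] PX X minus_0[OF X] by simp
  have QT: "(1\<^sub>m N - P)\<^sup>T = 1\<^sub>m N - P"
    using transpose_minus[OF one_carrier_mat P] PT by simp
  have "is_mp_inverse L X"
    unfolding is_mp_inverse_def using X L 1 2 LX XL QT by simp
  then have "L\<^sub>i = X"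
    by (rule mp_inverse_eqI)
  then show "L\<^sub>i \<in> carrier_mat N N" "L\<^sub>i\<^sup>T = L\<^sub>i" "L * L\<^sub>i * L = L" "L\<^sub>i * L * L\<^sub>i = L\<^sub>i"
    using X XT 1 2 by simp_all
qed

section \<open>The error as a sum of squared residuals\<close>

lemma laplacian_carrier: "L \<in> carrier_mat N N"
  by (simp add: laplacian_eq)

lemma B_mat_carrier: "B_mat d \<Theta> \<in> carrier_mat (m * d) N"
  by (simp add: B_mat_eq)

text \<open>For fixed \<open>T\<close>, the columns of this matrix are least-squares optimal positions of the points and
  translations of the views.\<close>

definition positions :: "real mat \<Rightarrow> real mat" where
  "positions T = T\<^sup>T * B_mat d \<Theta> * L\<^sub>i"

definition residual :: "real mat \<Rightarrow> nat \<times> nat \<Rightarrow> real vec" where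
  "residual T e = T\<^sup>T *\<^sub>v b e - positions T *\<^sub>v g e"

lemma positions_carrier:
  assumes "T \<in> carrier_mat (m * d) d"
  shows "positions T \<in> carrier_mat d N"
  using assms mp_inverse_laplacian(1) B_mat_carrier unfolding positions_def by simp

lemma residual_carrier:
  assumes "T \<in> carrier_mat (m * d) d"
  shows "residual T e \<in> carrier_vec d"
  using positions_carrier[OF assms] assms unfolding residual_def
  by (intro minus_carrier_vec mult_mat_vec_carrier[of _ d "m * d"] mult_mat_vec_carrier[of _ d N]) auto

text \<open>Write s_e and z_e for the two terms of the residual. The sums of s z^T, z s^T and z z^T
  all equal the same matrix \<open>V\<close>, which is \<open>T\<^sup>T\<close> B L^+ B^T T. Hence
  the square is \<open>T\<^sup>T\<close> D T - V - V + V = \<open>T\<^sup>T\<close> C T, and the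
  trace is cyclic.\<close>

lemma alignment_error_eq_trace:
  assumes T: "T \<in> carrier_mat (m * d) d"
  shows "alignment_error d \<Theta> T = trace_mat (outer_sum d d (residual T) (residual T) E)"
proof -
  let ?B = "B_mat d \<Theta>" and ?D = "D_mat d \<Theta>" and ?C = "C_mat d \<Theta>" and ?Z = "positions T"
  let ?s = "\<lambda>e. T\<^sup>T *\<^sub>v b e" and ?z = "\<lambda>e. ?Z *\<^sub>v g e"
  have TT: "T\<^sup>T \<in> carrier_mat d (m * d)"
    using T by simp
  have Z: "?Z \<in> carrier_mat d N" and ZT: "?Z\<^sup>T \<in> carrier_mat N d"
    using positions_carrier[OF T] by simp_all
  have B: "?B \<in> carrier_mat (m * d) N" and BT: "?B\<^sup>T \<in> carrier_mat N (m * d)"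
    using B_mat_carrier by simp_all
  note L = laplacian_carrier and X = mp_inverse_laplacian(1)
  have D: "?D \<in> carrier_mat (m * d) (m * d)"
    by (simp add: D_mat_eq)
  have BX: "?B * L\<^sub>i \<in> carrier_mat (m * d) N" and BTT: "?B\<^sup>T * T \<in> carrier_mat N d"
    using B X BT T by simp_all
  have BXB: "?B * L\<^sub>i * ?B\<^sup>T \<in> carrier_mat (m * d) (m * d)"
    using BX BT by simp
  define V where "V = ?Z * (?B\<^sup>T * T)"
  have V: "V \<in> carrier_mat d d"
    using Z BTT unfolding V_def by (rule mult_carrier_mat)
  have ZT_eq: "?Z\<^sup>T = L\<^sub>i * (?B\<^sup>T * T)"
    unfolding positions_def
    using transpose_mult[OF mult_carrier_mat[OF TT B] X] transpose_mult[OF TT B]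
      mp_inverse_laplacian(2) by simp
  have tb: "outer_sum d d ?s ?z E = V"
  proof -
    have "outer_sum d d ?s ?z E = T\<^sup>T * ?B * ?Z\<^sup>T"
      using mult_outer_sum[OF TT, of E b d ?z] outer_sum_mult[OF ZT, of E g "m * d" b]
        assoc_mult_mat[OF TT B ZT] by (simp add: B_mat_eq)
    also have "\<dots> = V"
      unfolding ZT_eq V_def unfolding positions_def
      using assoc_mult_mat[OF mult_carrier_mat[OF TT B] X BTT] by simp
    finally show ?thesis .
  qed
  have bt: "outer_sum d d ?z ?s E = V"
    using mult_outer_sum[OF Z, of E g d ?s] outer_sum_mult[OF T, of E b N g]
      by (simp add: B_mat_eq transpose_outer_sum V_def)
  have zz: "outer_sum d d ?z ?z E = V"
  proof -
    have "outer_sum d d ?z ?z E = ?Z * (L * ?Z\<^sup>T)"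
      using mult_outer_sum[OF Z, of E g d ?z] outer_sum_mult[OF ZT, of E g N g]
      by (simp add: laplacian_eq)
    also have "\<dots> = T\<^sup>T * ?B * (L\<^sub>i * (L * ?Z\<^sup>T))"
      unfolding positions_def
      using assoc_mult_mat[OF mult_carrier_mat[OF TT B] X mult_carrier_mat[OF L ZT]]
      by (simp add: positions_def)
    \<comment> \<open>The identity X L X = X of the pseudoinverse makes the purely quadratic term
      equal to the mixed ones.\<close>
    also have "L\<^sub>i * (L * ?Z\<^sup>T) = ?Z\<^sup>T"
      unfolding ZT_eq
      using assoc_mult_mat[OF L X BTT] assoc_mult_mat[OF X L mult_carrier_mat[OF X BTT]]
        assoc_mult_mat[OF mult_carrier_mat[OF X L] X BTT] mp_inverse_laplacian(4) by simp
    also have "T\<^sup>T * ?B * ?Z\<^sup>T = V"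
      unfolding ZT_eq V_def unfolding positions_def
      using assoc_mult_mat[OF mult_carrier_mat[OF TT B] X BTT] by simp
    finally show ?thesis .
  qed
  have ss: "outer_sum d d ?s ?s E = T\<^sup>T * (?D * T)"
    using mult_outer_sum[OF TT, of E b d ?s] outer_sum_mult[OF T, of E b "m * d" b]
    by (simp add: D_mat_eq)
  have DT: "T\<^sup>T * (?D * T) \<in> carrier_mat d d"
    using TT D T by simp
  have "outer_sum d d (residual T) (residual T) E = T\<^sup>T * (?D * T) - V - V + V"
    unfolding residual_def
    using outer_sum_diff[of E ?s d ?z] T Z by (simp add: ss tb bt zz)
  also have "\<dots> = T\<^sup>T * (?D * T) - V"
    using DT V by (intro eq_matI) auto
  also have "V = T\<^sup>T * (?B * L\<^sub>i * ?B\<^sup>T * T)"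
    unfolding V_def positions_def
    using assoc_mult_mat[OF TT B X] assoc_mult_mat[OF TT BX BTT] assoc_mult_mat[OF BX BT T] by simp
  also have "T\<^sup>T * (?D * T) - \<dots> = T\<^sup>T * (?C * T)"
    unfolding C_mat_def
    using minus_mult_distrib_mat[OF D BXB T]
      mult_minus_distrib_mat[OF TT mult_carrier_mat[OF D T] mult_carrier_mat[OF BXB T]] by simp
  finally have "trace_mat (outer_sum d d (residual T) (residual T) E) = trace_mat (T\<^sup>T * (?C * T))"
    by simp
  also have "?C * T \<in> carrier_mat (m * d) d"
    unfolding C_mat_def by (intro mult_carrier_mat[OF minus_carrier_mat[OF BXB] T])
  then have "trace_mat (T\<^sup>T * (?C * T)) = alignment_error d \<Theta> T"
    unfolding alignment_error_def by (rule trace_mult_comm[OF TT])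
  finally show ?thesis
    by simp
qed

lemma alignment_error_eq:
  assumes "T \<in> carrier_mat (m * d) d"
  shows "alignment_error d \<Theta> T = (\<Sum>e\<in>E. residual T e \<bullet> residual T e)"
  unfolding alignment_error_eq_trace[OF assms]
  by (rule trace_outer_sum) (rule residual_carrier[OF assms])

lemma alignment_error_nonneg:
  assumes "T \<in> carrier_mat (m * d) d"
  shows "0 \<le> alignment_error d \<Theta> T"
  unfolding alignment_error_eq[OF assms]
  by (intro sum_nonneg scalar_prod_self_ge_0)

lemma alignment_error_zeroD:
  assumes T: "T \<in> carrier_mat (m * d) d" and zero: "alignment_error d \<Theta> T = 0" and e: "e \<in> E"
  shows "T\<^sup>T *\<^sub>v b e = positions T *\<^sub>v g e"
proof -
  have "residual T e \<bullet> residual T e = 0"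
    using zero e sum_nonneg_eq_0_iff[OF finite_edges, of "\<lambda>e. residual T e \<bullet> residual T e"]
    unfolding alignment_error_eq[OF T] by (simp add: scalar_prod_self_ge_0)
  then have r: "residual T e = 0\<^sub>v d"
    using residual_carrier[OF T] by (rule scalar_prod_self_eq_0)
  have c: "T\<^sup>T *\<^sub>v b e \<in> carrier_vec d" "positions T *\<^sub>v g e \<in> carrier_vec d"
    using T positions_carrier[OF T] by (auto intro!: carrier_vecI)
  show ?thesis
    using r c unfolding residual_def by (rule minus_eq_zeroD)
qed

text \<open>\<open>Y\<close> need not be the least-squares solution. Its difference W to
  \<open>positions T\<close> satisfies W L = 0, by L X L = L, and the residual of e is W g_e. So the
  outer products of the residuals sum to \<open>W * L * W\<^sup>T\<close>, which is zero.\<close>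

lemma alignment_error_zeroI:
  assumes T: "T \<in> carrier_mat (m * d) d" and Y: "Y \<in> carrier_mat d N"
    and eq: "\<And>e. e \<in> E \<Longrightarrow> T\<^sup>T *\<^sub>v b e = Y *\<^sub>v g e"
  shows "alignment_error d \<Theta> T = 0"
proof -
  let ?Z = "positions T"
  note L = laplacian_carrier and X = mp_inverse_laplacian(1)
  have TT: "T\<^sup>T \<in> carrier_mat d (m * d)"
    using T by simp
  have Z: "?Z \<in> carrier_mat d N"
    by (rule positions_carrier[OF T])
  define W where "W = Y - ?Z"
  have W: "W \<in> carrier_mat d N"
    unfolding W_def using Z by (rule minus_carrier_mat)
  have "T\<^sup>T * B_mat d \<Theta> = outer_sum d N (\<lambda>e. T\<^sup>T *\<^sub>v b e) g E"
    unfolding B_mat_eq by (rule mult_outer_sum[OF TT]) simp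
  also have "\<dots> = outer_sum d N (\<lambda>e. Y *\<^sub>v g e) g E"
    by (rule outer_sum_cong) (simp_all add: eq)
  also have "\<dots> = Y * L"
    unfolding laplacian_eq by (rule mult_outer_sum[OF Y, symmetric]) simp
  finally have "?Z * L = Y * L * L\<^sub>i * L"
    by (simp add: positions_def)
  also have "\<dots> = Y * L"
    using assoc_mult_mat[OF Y L X] assoc_mult_mat[OF Y mult_carrier_mat[OF L X] L]
      mp_inverse_laplacian(3) by simp
  finally have ZL: "?Z * L = Y * L" .
  have "W * L = Y * L - Y * L"
    using minus_mult_distrib_mat[OF Y Z L] ZL by (simp add: W_def)
  also have "\<dots> = 0\<^sub>m d N"
    using mult_carrier_mat[OF Y L] by simp
  finally have WL: "W * L = 0\<^sub>m d N" .
  have r: "residual T e = W *\<^sub>v g e" if "e \<in> E" for e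
    unfolding residual_def W_def eq[OF that] using minus_mult_distrib_mat_vec[OF Y Z] by simp
  have "outer_sum d d (residual T) (residual T) E = outer_sum d d (\<lambda>e. W *\<^sub>v g e) (\<lambda>e. W *\<^sub>v g e) E"
    by (rule outer_sum_cong) (simp_all add: r)
  also have "\<dots> = W * (L * W\<^sup>T)"
    using mult_outer_sum[OF W, of E g d "\<lambda>e. W *\<^sub>v g e"] outer_sum_mult[of "W\<^sup>T" N d E g N g] W
    by (simp add: laplacian_eq)
  also have "\<dots> = 0\<^sub>m d d"
    using assoc_mult_mat[OF W L, of "W\<^sup>T" d] W by (simp add: WL)
  finally show ?thesis
    unfolding alignment_error_eq_trace[OF T] by (simp add: trace_mat_def)
qed

section \<open>Aligned points as columns of \<open>H_mat\<close>\<close>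

lemma H_mat_carrier:
  assumes "S \<in> carrier_mat (m * d) d"
  shows "H_mat d \<Theta> S \<in> carrier_mat d N"
  unfolding H_mat_def positions_def[symmetric]
  by (rule mult_carrier_mat[OF positions_carrier[OF assms]])
    (intro minus_carrier_mat smult_carrier_mat, auto simp: ones_mat_def)

text \<open>Zero residuals express each turned local point as column k minus column n + i of
  \<open>positions S\<close>. Passing to \<open>H_mat\<close> shifts all columns by one common
  vector, which such differences do not see. Adding the translation then leaves column k, whatever
  the view.\<close>

lemma aligned_point_eq:
  assumes S: "perfect_alignment d \<Theta> S" and e: "(k, i) \<in> E"
  shows "aligned_point d \<Theta> S k i = col (H_mat d \<Theta> S) k"
    and "S\<^sup>T *\<^sub>v b (k, i) = H_mat d \<Theta> S *\<^sub>v g (k, i)"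
proof -
  have Sc: "S \<in> carrier_mat (m * d) d"
    using S unfolding perfect_alignment_def alignment_def by blast
  define p where "p = col_mat (vec N (\<lambda>v. if v < n then 1 else 0))"
  define J where "J = p * (ones_mat N 1)\<^sup>T"
  have p: "p \<in> carrier_mat N 1" and o: "(ones_mat N 1)\<^sup>T \<in> carrier_mat 1 N"
    by (auto simp: p_def ones_mat_def intro!: carrier_matI)
  have J: "J \<in> carrier_mat N N"
    unfolding J_def using p o by (rule mult_carrier_mat)
  have H_def: "H_mat d \<Theta> S = positions S * (1\<^sub>m N - (1 / real n) \<cdot>\<^sub>m J)"
    unfolding H_mat_def positions_def J_def p_def ..
  have Z: "positions S \<in> carrier_mat d N"
    by (rule positions_carrier[OF Sc])
  have W: "1\<^sub>m N - (1 / real n) \<cdot>\<^sub>m J \<in> carrier_mat N N"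
    by (intro minus_carrier_mat smult_carrier_mat J)
  have H: "H_mat d \<Theta> S \<in> carrier_mat d N"
    by (rule H_mat_carrier[OF Sc])
  have "J *\<^sub>v g (k, i) = p *\<^sub>v ((ones_mat N 1)\<^sup>T *\<^sub>v g (k, i))"
    unfolding J_def by (rule assoc_mult_mat_vec[OF p o]) simp
  also have "(ones_mat N 1)\<^sup>T *\<^sub>v g (k, i) = 0\<^sub>v 1"
    using edgeD[OF e] mult_edge_diff[OF o] by (intro eq_vecI) (auto simp: ones_mat_def)
  also have "p *\<^sub>v 0\<^sub>v 1 = 0\<^sub>v N"
    using p by (intro eq_vecI) auto
  finally have "J *\<^sub>v g (k, i) = 0\<^sub>v N" .
  then have "(1\<^sub>m N - (1 / real n) \<cdot>\<^sub>m J) *\<^sub>v g (k, i) = g (k, i) - (1 / real n) \<cdot>\<^sub>v 0\<^sub>v N"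
    using J by (subst minus_mult_distrib_mat_vec[of _ N N]) (simp_all add: smult_mult_mat_vec carrier_vecD[OF edge_diff_carrier])
  also have "\<dots> = g (k, i)"
    by (intro eq_vecI) (simp_all add: carrier_vecD[OF edge_diff_carrier])
  finally have "H_mat d \<Theta> S *\<^sub>v g (k, i) = positions S *\<^sub>v g (k, i)"
    unfolding H_def using assoc_mult_mat_vec[OF Z W] by simp
  then show *: "S\<^sup>T *\<^sub>v b (k, i) = H_mat d \<Theta> S *\<^sub>v g (k, i)"
    using alignment_error_zeroD[OF Sc _ e] S by (simp add: perfect_alignment_def)
  have "aligned_point d \<Theta> S k i = (col (H_mat d \<Theta> S) k - col (H_mat d \<Theta> S) (n + i)) + col (H_mat d \<Theta> S) (n + i)"
    using * edgeD[OF e]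
    by (simp add: aligned_point_def translation_def transpose_mult_stacked_coord[OF Sc, symmetric]
        mult_edge_diff[OF H])
  also have "\<dots> = col (H_mat d \<Theta> S) k"
    using H by (intro eq_vecI) auto
  finally show "aligned_point d \<Theta> S k i = col (H_mat d \<Theta> S) k" .
qed

section \<open>Reflecting the views of one side\<close>

text \<open>The factor stands on the right because a block acts on coordinates through its
  transpose; the aligned view is thus moved by \<open>R\<^sup>T\<close>.\<close>

definition reflect_views :: "nat set \<Rightarrow> real mat \<Rightarrow> real mat \<Rightarrow> real mat" where
  "reflect_views B R S = mat (m * d) d
     (\<lambda>(a, c). if a div d \<in> B then (S * R) $$ (a, c) else S $$ (a, c))"

lemma reflect_views_carrier: "reflect_views B R S \<in> carrier_mat (m * d) d"
  by (simp add: reflect_views_def)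

lemma block_reflect_views:
  assumes "S \<in> carrier_mat (m * d) d" "R \<in> carrier_mat d d" "i < m"
  shows "block d (reflect_views B R S) i = (if i \<in> B then block d S i * R else block d S i)"
proof -
  have "block d (reflect_views B R S) i = (if i \<in> B then block d (S * R) i else block d S i)"
    using block_index_less[OF assms(3)] by (intro eq_matI) (auto simp: block_def reflect_views_def)
  then show ?thesis
    using block_mult[OF assms] by simp
qed

text \<open>The new positions are \<open>Y\<close>: the reflection \<open>\<phi>\<close> in the hyperplane \<open>u \<bullet> x = c\<close> moves the views of \<open>B\<close>
  and their points. Its translation part is absorbed by the columns of \<open>Y\<close> that belong to views.\<close>

lemma reflect_views_perfect:
  assumes S: "perfect_alignment d \<Theta> S"
    and u: "u \<in> carrier_vec d" "u \<noteq> 0\<^sub>v d"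
    and AB: "A \<inter> B = {}" "A \<union> B = {..<m}"
    and c: "\<And>k. k \<in> overlap_points \<Theta> A B \<Longrightarrow> u \<bullet> col (H_mat d \<Theta> S) k = c"
  shows "perfect_alignment d \<Theta> (reflect_views B (reflection d u) S)"
proof -
  define H where "H = H_mat d \<Theta> S"
  define R where "R = reflection d u"
  define T where "T = reflect_views B R S"
  \<comment> \<open>For the linear reflection this is x - 2 (u . x - c) / (u . u) u; the added
    multiple of u shifts the mirror from height 0 to height c.\<close>
  define \<phi> where "\<phi> x = R *\<^sub>v x + (2 / (u \<bullet> u) * c) \<cdot>\<^sub>v u" for x
  \<comment> \<open>A point moves as soon as some view of \<open>B\<close> contains it, even if a
    view of \<open>A\<close> does too.\<close>
  define moved where
    "moved v \<longleftrightarrow> (\<exists>i\<in>B. (v, i) \<in> E) \<or> (n \<le> v \<and> v - n \<in> B)" for v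
  define Y where "Y = mat d N (\<lambda>(a, v). if moved v then \<phi> (col H v) $ a else H $$ (a, v))"
  have R: "R \<in> carrier_mat d d" and RT: "R\<^sup>T = R"
    by (simp_all add: R_def transpose_reflection)
  have Sc: "S \<in> carrier_mat (m * d) d"
    and Sb: "\<And>i. i < m \<Longrightarrow> block d S i \<in> orthogonal_group d"
    using S unfolding perfect_alignment_def alignment_def by auto
  have H: "H \<in> carrier_mat d N"
    unfolding H_def by (rule H_mat_carrier[OF Sc])
  have T: "T \<in> carrier_mat (m * d) d"
    by (simp add: T_def reflect_views_carrier)
  have blk: "block d T i = (if i \<in> B then block d S i * R else block d S i)" if "i < m" for i
    unfolding T_def by (rule block_reflect_views[OF Sc R that])
  have Y: "Y \<in> carrier_mat d N"
    by (simp add: Y_def)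
  have \<phi>_carrier: "\<phi> x \<in> carrier_vec d" if "x \<in> carrier_vec d" for x
    unfolding \<phi>_def using mult_mat_vec_carrier[OF R that] u(1) by simp
  have Hv: "col H v \<in> carrier_vec d" for v
    using H by (simp add: carrier_vecI)
  have colY: "col Y v = (if moved v then \<phi> (col H v) else col H v)" if "v < N" for v
    using that H \<phi>_carrier[OF Hv[of v]]
    by (intro eq_vecI) (auto simp: Y_def dest!: carrier_vecD)
  \<comment> \<open>The offset cancels in differences, so an edge with both ends moved feels only
    the linear part.\<close>
  have \<phi>_diff: "\<phi> x - \<phi> y = R *\<^sub>v (x - y)" if "x \<in> carrier_vec d" "y \<in> carrier_vec d" for x y
  proof -
    have "R *\<^sub>v x \<in> carrier_vec d" "R *\<^sub>v y \<in> carrier_vec d"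
      using mult_mat_vec_carrier[OF R] that by auto
    then show ?thesis
      unfolding mult_minus_distrib_mat_vec[OF R that] \<phi>_def
      by (rule add_diff_add_vec) (use u(1) in simp)
  qed
  have \<phi>_fix: "\<phi> x = x" if x: "x \<in> carrier_vec d" "u \<bullet> x = c" for x
    unfolding \<phi>_def R_def reflection_mult_vec[OF u(1) x(1)] x(2)
    using x(1) u(1) by (intro eq_vecI) auto
  have "T\<^sup>T *\<^sub>v b e = Y *\<^sub>v g e" if e: "e \<in> E" for e
  proof -
    obtain k i where ki: "e = (k, i)"
      by fastforce
    note ed = edgeD[OF e[unfolded ki]]
    have x: "coord \<Theta> k i \<in> carrier_vec d"
      by (rule ed)
    have TTb: "T\<^sup>T *\<^sub>v b e = (block d T i)\<^sup>T *\<^sub>v coord \<Theta> k i"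
      unfolding ki by (rule transpose_mult_stacked_coord[OF T ed(3,2)])
    have Hd: "(block d S i)\<^sup>T *\<^sub>v coord \<Theta> k i = col H k - col H (n + i)"
      using aligned_point_eq(2)[OF S e[unfolded ki]] mult_edge_diff[OF H ed(1,2)]
        transpose_mult_stacked_coord[OF Sc ed(3,2)] by (simp add: H_def)
    have Yd: "Y *\<^sub>v g e = col Y k - col Y (n + i)"
      unfolding ki by (rule mult_edge_diff[OF Y ed(1,2)])
    have less: "k < N" "n + i < N"
      using ed by auto
    show ?thesis
    proof (cases "i \<in> B")
      case True
      then have "moved k" "moved (n + i)"
        using e ki by (auto simp: moved_def)
      then have "Y *\<^sub>v g e = R *\<^sub>v ((block d S i)\<^sup>T *\<^sub>v coord \<Theta> k i)"
        unfolding Yd colY[OF less(1)] colY[OF less(2)] Hd using \<phi>_diff[OF Hv Hv] by simp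
      also have "\<dots> = (R * (block d S i)\<^sup>T) *\<^sub>v coord \<Theta> k i"
        by (rule assoc_mult_mat_vec[OF R _ x, symmetric]) simp
      also have "R * (block d S i)\<^sup>T = (block d T i)\<^sup>T"
        using transpose_mult[OF block_carrier R, of S i] blk[OF ed(2)] True RT by simp
      finally show ?thesis
        unfolding TTb by simp
    next
      case False
      then have "i \<in> A"
        using ed(2) AB(2) by auto
      have "\<not> moved (n + i)"
        using False framework unfolding moved_def patch_framework_def by auto
      \<comment> \<open>A moved point in a view of \<open>A\<close> is an overlap point; it lies on
        the mirror and stays where it was.\<close>
      moreover have "col Y k = col H k"
      proof (cases "moved k")
        case True
        then obtain j where "j \<in> B" "(k, j) \<in> E"
          using ed(1) unfolding moved_def by auto
        then have "k \<in> overlap_points \<Theta> A B"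
          using \<open>i \<in> A\<close> e ki unfolding overlap_points_def by blast
        then have "\<phi> (col H k) = col H k"
          using c by (intro \<phi>_fix Hv) (simp add: H_def)
        then show ?thesis
          using colY[OF less(1)] by simp
      qed (simp add: colY less)
      ultimately show ?thesis
        unfolding TTb Yd blk[OF ed(2)] colY[OF less(2)] using False Hd by simp
    qed
  qed
  then have "alignment_error d \<Theta> T = 0"
    by (rule alignment_error_zeroI[OF T Y])
  moreover have "alignment d \<Theta> T"
    unfolding alignment_def using T blk Sb orthogonal_group_mult reflection_orthogonal[OF u]
    by (simp add: R_def)
  ultimately show ?thesis
    by (simp add: perfect_alignment_def T_def R_def)
qed

section \<open>From the reflected alignment to the rank\<close>

lemma perfect_imp_optimal: "perfect_alignment d \<Theta> T \<Longrightarrow> optimal_alignment d \<Theta> T"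
  unfolding perfect_alignment_def optimal_alignment_def
  using alignment_error_nonneg by (auto simp: alignment_def)

lemma finite_overlap_points: "finite (overlap_points \<Theta> A B)"
  by (rule finite_subset[of _ "{..<n}"]) (auto simp: overlap_points_def dest: edgeD)

text \<open>By \<open>aligned_point_eq\<close> the view picked by \<open>LEAST\<close> does not
  influence the column.\<close>

lemma col_overlap_mat:
  assumes S: "perfect_alignment d \<Theta> S" and k: "k \<in> overlap_points \<Theta> A B"
  obtains j where "j < card (overlap_points \<Theta> A B)"
    "col (overlap_mat d \<Theta> S A B) j = col (H_mat d \<Theta> S) k"
proof -
  let ?ks = "sorted_list_of_set (overlap_points \<Theta> A B)"
  let ?i = "LEAST i. i \<in> A \<and> (k, i) \<in> edges \<Theta>"
  obtain j where j: "j < length ?ks" "?ks ! j = k"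
    using k finite_overlap_points[of A B] by (metis in_set_conv_nth set_sorted_list_of_set)
  have e: "(k, ?i) \<in> E"
    using k LeastI_ex[of "\<lambda>i. i \<in> A \<and> (k, i) \<in> E"] unfolding overlap_points_def by blast
  have ap: "aligned_point d \<Theta> S k ?i = col (H_mat d \<Theta> S) k"
    by (rule aligned_point_eq(1)[OF S e])
  have "S \<in> carrier_mat (m * d) d"
    using S unfolding perfect_alignment_def alignment_def by blast
  then have "H_mat d \<Theta> S \<in> carrier_mat d N"
    by (rule H_mat_carrier)
  then have "col (H_mat d \<Theta> S) k \<in> carrier_vec d"
    by (simp add: carrier_vecI)
  then have "col (overlap_mat d \<Theta> S A B) j = col (H_mat d \<Theta> S) k"
    unfolding overlap_mat_def using j ap by (subst col_mat_of_cols) auto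
  then show ?thesis
    using that j by simp
qed

lemma overlap_rank:
  assumes S: "perfect_alignment d \<Theta> S" and unique: "unique_alignment d \<Theta> S"
    and AB: "A \<noteq> {}" "B \<noteq> {}" "A \<inter> B = {}" "A \<union> B = {..<m}"
  shows "vec_space.rank d (centered (overlap_mat d \<Theta> S A B)) = d"
proof (rule ccontr)
  let ?M = "overlap_mat d \<Theta> S A B" and ?q = "card (overlap_points \<Theta> A B)"
  assume rank: "vec_space.rank d (centered ?M) \<noteq> d"
  have M: "?M \<in> carrier_mat d ?q"
    unfolding overlap_mat_def by (intro carrier_matI) auto
  have "centered ?M \<in> carrier_mat d ?q"
    using M unfolding centered_def by (intro carrier_matI) (auto simp: ones_mat_def)
  then obtain u where u: "u \<in> carrier_vec d" "u \<noteq> 0\<^sub>v d" and "(centered ?M)\<^sup>T *\<^sub>v u = 0\<^sub>v ?q"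
    using rank by (rule rank_less_imp_orthogonal)
  then obtain c where c: "\<And>j. j < ?q \<Longrightarrow> u \<bullet> col ?M j = c"
    using centered_orthogonal[OF M u(1)] by blast
  \<comment> \<open>All overlap points lie at height c. With no overlap points this is vacuous and c
    is arbitrary.\<close>
  have "u \<bullet> col (H_mat d \<Theta> S) k = c" if "k \<in> overlap_points \<Theta> A B" for k
    using col_overlap_mat[OF S that] c by metis
  then have "perfect_alignment d \<Theta> (reflect_views B (reflection d u) S)" (is "perfect_alignment d \<Theta> ?T")
    by (rule reflect_views_perfect[OF S u AB(3,4)])
  then have opt: "optimal_alignment d \<Theta> ?T"
    by (rule perfect_imp_optimal)
  have Sc: "S \<in> carrier_mat (m * d) d"
    and Sb: "\<And>i. i < m \<Longrightarrow> block d S i \<in> orthogonal_group d"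
    using S unfolding perfect_alignment_def alignment_def by auto
  note blk = block_reflect_views[OF Sc reflection_carrier[of d u], where B = B]
  obtain i j where ij: "i \<in> A" "j \<in> B"
    using AB by blast
  then have less: "i < m" "j < m" and "i \<notin> B"
    using AB by auto
  have "?T \<noteq> S"
  proof
    assume "?T = S"
    then have "block d S j * reflection d u = block d S j"
      using blk[OF less(2)] ij(2) by simp
    then show False
      using orthogonal_group_cancel[OF Sb[OF less(2)] reflection_carrier] reflection_ne_one[OF u]
      by blast
  qed
  moreover have "?T = S"
  proof -
    obtain Q where Q: "Q \<in> orthogonal_group d" "?T = S * Q"
      using unique opt \<open>?T \<noteq> S\<close> unfolding unique_alignment_def by blast
    have Qc: "Q \<in> carrier_mat d d"
      using Q(1) unfolding orthogonal_group_def by simp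
    \<comment> \<open>View i belongs to \<open>A\<close> and was not reflected, so its block forces
      \<open>Q\<close> to be the identity.\<close>
    have "block d S i * Q = block d S i"
      using blk[OF less(1)] block_mult[OF Sc Qc less(1)] \<open>i \<notin> B\<close> Q(2) by simp
    then have "Q = 1\<^sub>m d"
      by (rule orthogonal_group_cancel[OF Sb[OF less(1)] Qc])
    then show ?thesis
      using Q(2) Sc by simp
  qed
  ultimately show False
    by simp
qed

end

theorem theorem4p8:
  fixes d :: nat and \<Theta> :: patch and S :: "real mat"
  assumes "patch_framework d \<Theta>"
    and "connected (with_proj (patch_graph \<Theta>))"
    and "\<forall>i<nviews \<Theta>. affinely_nondegenerate d \<Theta> i"
    and "perfect_alignment d \<Theta> S"
    and "unique_alignment d \<Theta> S"
  shows "\<forall>A B. A \<noteq> {} \<and> B \<noteq> {} \<and> A \<inter> B = {} \<and> A \<union> B = {..<nviews \<Theta>} \<longrightarrow>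
           vec_space.rank d (centered (overlap_mat d \<Theta> S A B)) = d"
proof -
  interpret connected_patch d \<Theta>
    by (rule connected_patch.intro[OF assms(1,2)])
  show ?thesis
    using overlap_rank[OF assms(4,5)] by blast
qed

end
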